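(* Let $\mu>1$. For any integer $n\ge2$ and any integer $m>0$, $\widehat\varphi^{(n,m)}$ has a zero of order $n-1$ at $\omega=2^{m+1}\pi\alpha$ for every $\alpha\in\mathbb{Z}\setminus\{0\}$. Moreover, $\widehat\varphi^{(n,0)}$ has a simple zero at $\omega=2\pi\alpha$ for every $\alpha\in\mathbb{Z}\setminus\{0\}$.
   Context: The Fourier transform is $\widehat f(\omega)=\int_{\mathbb{R}} f(x)e^{-i\omega x}\,dx$. Masks: fix a real parameter $\mu>1$. For an integer $n\ge 2$, let $a^{(n,0)}_0=a^{(n,0)}_1=\tfrac12$ and $a^{(n,0)}_\alpha=0$ otherwise; for $m\ge 1$ let $$a^{(n,m)}_\alpha=\frac{1}{2^{n+1+m^{-\mu}}}\left[\binom{n+1}{\alpha}+4\bigl(2^{m^{-\mu}}-1\bigr)\binom{n-1}{\alpha-1}\right],\quad 0\le\alpha\le n+1,$$ and $a^{(n,m)}_\alpha=0$ otherwise (with $\binom{p}{q}=0$ if $q<0$ or $q>p$). The symbols are $A^{(n,m)}(z)=\sum_\alpha a^{(n,m)}_\alpha z^\alpha$. Refinable functions: for integers $m\ge0$, $\varphi^{(n,m)}\in L_2(\mathbb{R})$ is the compactly supported function with $\widehat{\varphi}^{(n,m)}(\omega)=\prod_{k=m}^{\infty}A^{(n,k)}\bigl(e^{-i\omega/2^{k+1}}\bigr)$.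
   Formalization: The second claim is false for even α when n≥3 (for n=3, α=2 the zero at 4π is double); it is replaced by: the transform of φ^(n,0) vanishes at 2πα for every α≠0, and the zero is simple when α is odd or n=2. *)

theory Defs
  imports "HOL-Complex_Analysis.Complex_Analysis"
begin

text \<open>The coefficients vanish outside \<open>{0..n+1}\<close>, so only natural indices are needed.
  The conditional at \<open>\<alpha> = 0\<close> implements the convention that the binomial coefficient
  \<open>n - 1\<close> over \<open>-1\<close> is zero (truncated subtraction would give \<open>1\<close>).\<close>

definition mask :: "real \<Rightarrow> nat \<Rightarrow> nat \<Rightarrow> nat \<Rightarrow> real" where
  "mask \<mu> n m \<alpha> =
     (if m = 0 then (if \<alpha> = 0 \<or> \<alpha> = 1 then 1 / 2 else 0)
      else if \<alpha> \<le> n + 1 then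
        1 / 2 powr (real n + 1 + real m powr (- \<mu>)) *
        (real ((n + 1) choose \<alpha>)
         + 4 * (2 powr (real m powr (- \<mu>)) - 1)
             * (if \<alpha> = 0 then 0 else real ((n - 1) choose (\<alpha> - 1))))
      else 0)"

definition mask_symbol :: "real \<Rightarrow> nat \<Rightarrow> nat \<Rightarrow> complex \<Rightarrow> complex" where
  "mask_symbol \<mu> n m z = (\<Sum>\<alpha>\<le>n + 1. of_real (mask \<mu> n m \<alpha>) * z ^ \<alpha>)"

text \<open>The Fourier integral, taken at complex frequencies. For compactly supported integrable
  \<open>f\<close> it is the entire extension of the Fourier transform on the real line, and the order
  of a real zero is the order of the zero of this extension.\<close>

definition fourier :: "(real \<Rightarrow> complex) \<Rightarrow> complex \<Rightarrow> complex" where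
  "fourier f \<omega> = (LINT x|lborel. f x * exp (- (\<i> * \<omega> * of_real x)))"

text \<open>\<open>f\<close> is (a representative of) the refinable function with parameters \<open>n\<close> and \<open>m\<close>:
  a compactly supported square integrable function with the prescribed Fourier transform on
  the real line. It is determined almost everywhere. The product over \<open>k \<ge> m\<close> is
  reindexed to start at \<open>0\<close>.\<close>

definition is_refinable_fun :: "real \<Rightarrow> nat \<Rightarrow> nat \<Rightarrow> (real \<Rightarrow> complex) \<Rightarrow> bool" where
  "is_refinable_fun \<mu> n m f \<longleftrightarrow>
     f \<in> borel_measurable lborel \<and>
     integrable lborel (\<lambda>x. (norm (f x))\<^sup>2) \<and>
     compact (closure {x. f x \<noteq> 0}) \<and>
     (\<forall>\<omega>::real. fourier f (of_real \<omega>) =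
        (\<Prod>k. mask_symbol \<mu> n (m + k) (exp (- (\<i> * of_real \<omega> / 2 ^ (m + k + 1))))))"

text \<open>The side conditions exclude the cases in which \<open>zorder\<close> is not specified.\<close>

definition has_zero_of_order :: "(complex \<Rightarrow> complex) \<Rightarrow> nat \<Rightarrow> complex \<Rightarrow> bool" where
  "has_zero_of_order F k z \<longleftrightarrow>
     F analytic_on {z} \<and> F z = 0 \<and> (\<forall>\<^sub>F w in at z. F w \<noteq> 0) \<and> zorder F z = int k"

end

theory Submission
  imports Defs
begin

text \<open>Write \<open>s = m powr -\<mu>\<close>. For \<open>m > 0\<close> the symbol factors as
  \<open>A(z) = c (1 + z)^(n - 1) (1 + (4 * 2 powr s - 2) z + z\<^sup>2)\<close> with \<open>c \<noteq> 0\<close>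
  (\<open>mask_symbol_pos\<close>). Since \<open>s > 0\<close>, one has \<open>2 powr s > 1\<close>, so the middle
  coefficient exceeds \<open>2\<close> and the quadratic cannot vanish on the unit circle, where its outer
  terms have modulus at most \<open>2\<close> together. Hence on the unit circle \<open>A\<close> vanishes only at
  \<open>-1\<close>, to order exactly \<open>n - 1\<close>. For \<open>m = 0\<close> the symbol is \<open>(1 + z) / 2\<close>, with a simple
  zero at \<open>-1\<close>.

  At \<open>\<omega> = 2 ^ (m + 1) \<pi> \<alpha>\<close> the \<open>k\<close>-th factor of the product is evaluated at
  \<open>exp (-\<i> \<pi> \<alpha> / 2 ^ k)\<close>, which is \<open>-1\<close> precisely when \<open>\<alpha> / 2 ^ k\<close> is an odd integer,
  that is, when \<open>k\<close> is the exponent \<open>j\<close> of \<open>2\<close> in \<open>\<alpha>\<close>. So exactly one factor vanishes at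
  \<open>\<omega>\<close>, and the order of the zero of the product is the order of the zero of that factor
  (\<open>prodinf_has_zero_of_order\<close>): it is \<open>n - 1\<close>, unless \<open>m + j = 0\<close>, when it is \<open>1\<close>.

  To speak of orders one needs the product formula at complex frequencies. The
  Fourier integral of a compactly supported square integrable function is entire
  (\<open>fourier_entire\<close>). The infinite product is entire as well, since its \<open>k\<close>-th factor
  differs from \<open>1\<close> by \<open>O(2 ^ -k)\<close> locally uniformly. Both agree on the real line, hence
  everywhere (\<open>fourier_refinable_eq_prodinf\<close>).\<close>

section \<open>Fourier integrals of compactly supported functions\<close>

text \<open>The bound is \<open>\<bar>f\<bar> \<le> 1 + \<bar>f\<bar>\<^sup>2\<close> on the support of \<open>f\<close>, and on a bounded set the constant \<open>1\<close>
  is integrable.\<close>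

lemma integrable_of_square_integrable_bounded_support:
  fixes f :: "real \<Rightarrow> complex"
  assumes [measurable]: "f \<in> borel_measurable lborel"
    and sq: "integrable lborel (\<lambda>x. (norm (f x))\<^sup>2)"
    and supp: "\<And>x. f x \<noteq> 0 \<Longrightarrow> \<bar>x\<bar> \<le> r"
  shows "integrable lborel f"
proof (rule Bochner_Integration.integrable_bound)
  have "integrable lborel (indicator {-r..r} :: real \<Rightarrow> real)"
    by (cases "-r \<le> r") (auto intro!: integrable_real_indicator)
  then show "integrable lborel (\<lambda>x. indicator {-r..r} x + (norm (f x))\<^sup>2)"
    using sq by (rule Bochner_Integration.integrable_add)
  have "norm (f x) \<le> norm (indicator {-r..r} x + (norm (f x))\<^sup>2)" for x
  proof (cases "f x = 0")
    case False
    with supp[of x] have "indicator {-r..r} x = (1::real)"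
      by (simp add: abs_le_iff minus_le_iff)
    moreover have "norm (f x) \<le> 1 + (norm (f x))\<^sup>2"
      using sum_squares_bound[of 1 "norm (f x)"] by (simp add: power2_eq_square) (smt (verit) norm_ge_zero zero_le_square)
    ultimately show ?thesis by simp
  qed simp
  then show "AE x in lborel. norm (f x) \<le> norm (indicator {-r..r} x + (norm (f x))\<^sup>2)"
    by simp
qed auto

text \<open>Expanding the exponential gives a power series in \<open>w\<close> whose coefficients are the moments
  of \<open>f\<close> up to constants. Integration term by term is legitimate for every \<open>w\<close>: on the support
  of \<open>f\<close> the \<open>k\<close>-th term is at most \<open>\<bar>f x\<bar> (r \<bar>w\<bar>) ^ k / k!\<close>.\<close>

lemma fourier_entire:
  fixes f :: "real \<Rightarrow> complex"
  assumes int: "integrable lborel f"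
    and supp: "\<And>x. f x \<noteq> 0 \<Longrightarrow> \<bar>x\<bar> \<le> r"
  shows "fourier f holomorphic_on UNIV"
proof -
  have [measurable]: "f \<in> borel_measurable lborel"
    using int by auto
  define c where "c = (\<lambda>k. (LINT x|lborel. f x * (-\<i> * of_real x) ^ k / fact k))"
  have "(\<lambda>k. c k * (w - 0) ^ k) sums fourier f w" for w
  proof -
    define t where "t = (\<lambda>(k::nat) (x::real). f x * ((-\<i> * of_real x) * w) ^ k / fact k)"
    have bound: "norm (t k x) \<le> norm (f x) * ((\<bar>r\<bar> * norm w) ^ k / fact k)"
      for k :: nat and x :: real
    proof (cases "f x = 0")
      case False
      with supp have "\<bar>x\<bar> \<le> \<bar>r\<bar>" by fastforce
      then have "(\<bar>x\<bar> * norm w) ^ k \<le> (\<bar>r\<bar> * norm w) ^ k"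
        by (intro power_mono mult_right_mono) auto
      then have "(\<bar>x\<bar> * norm w) ^ k / fact k \<le> (\<bar>r\<bar> * norm w) ^ k / fact k"
        by (intro divide_right_mono) auto
      then have "norm (f x) * ((\<bar>x\<bar> * norm w) ^ k / fact k) \<le> norm (f x) * ((\<bar>r\<bar> * norm w) ^ k / fact k)"
        by (intro mult_left_mono) auto
      then show ?thesis
        by (simp add: t_def norm_mult norm_divide norm_power)
    qed (simp add: t_def)
    have exps: "(\<lambda>k. ((-\<i> * of_real x) * w) ^ k / fact k) sums exp (-(\<i> * w * of_real x))" for x
      using exp_converges[of "(-\<i> * of_real x) * w"]
      by (simp add: scaleR_conv_of_real divide_simps mult_ac)
    have sumr: "summable (\<lambda>k. (\<bar>r\<bar> * norm w) ^ k / fact k)"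
      using summable_exp[of "\<bar>r\<bar> * norm w"] by (simp add: field_simps)
    have intt: "integrable lborel (t k)" for k
    proof (rule Bochner_Integration.integrable_bound)
      show "integrable lborel (\<lambda>x. norm (f x) * ((\<bar>r\<bar> * norm w) ^ k / fact k))"
        using int by (intro integrable_mult_left integrable_norm)
      show "AE x in lborel. norm (t k x) \<le> norm (norm (f x) * ((\<bar>r\<bar> * norm w) ^ k / fact k))"
      proof (rule AE_I2)
        fix x
        have "0 \<le> norm (f x) * ((\<bar>r\<bar> * norm w) ^ k / fact k)" by simp
        with bound[of k x] show "norm (t k x) \<le> norm (norm (f x) * ((\<bar>r\<bar> * norm w) ^ k / fact k))"
          by (simp only: real_norm_def abs_of_nonneg)
      qed
    qed (simp add: t_def)
    have "(\<lambda>k. integral\<^sup>L lborel (t k)) sums (LINT x|lborel. (\<Sum>k. t k x))"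
    proof (rule sums_integral)
      show "integrable lborel (t k)" for k by (rule intt)
      show "AE x in lborel. summable (\<lambda>k. norm (t k x))"
      proof (rule AE_I2)
        fix x
        show "summable (\<lambda>k. norm (t k x))"
        proof (rule summable_comparison_test')
          show "summable (\<lambda>k. norm (f x) * ((\<bar>r\<bar> * norm w) ^ k / fact k))"
            by (intro summable_mult sumr)
          show "norm (norm (t k x)) \<le> norm (f x) * ((\<bar>r\<bar> * norm w) ^ k / fact k)" for k
            using bound[of k x] by simp
        qed
      qed
      show "summable (\<lambda>k. LINT x|lborel. norm (t k x))"
      proof (rule summable_comparison_test')
        show "summable (\<lambda>k. (LINT x|lborel. norm (f x)) * ((\<bar>r\<bar> * norm w) ^ k / fact k))"
          by (intro summable_mult sumr)
        fix k
        have "(LINT x|lborel. norm (t k x)) \<le> (LINT x|lborel. norm (f x) * ((\<bar>r\<bar> * norm w) ^ k / fact k))"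
          by (intro integral_mono integrable_norm intt integrable_mult_left int bound)
        also have "\<dots> = (LINT x|lborel. norm (f x)) * ((\<bar>r\<bar> * norm w) ^ k / fact k)"
          by (rule integral_mult_left_zero)
        finally show "norm (LINT x|lborel. norm (t k x)) \<le> \<dots>"
          by (subst real_norm_def, subst abs_of_nonneg) (auto intro!: integral_nonneg_AE)
      qed
    qed
    moreover have "(\<Sum>k. t k x) = f x * exp (-(\<i> * w * of_real x))" for x
      using sums_mult[OF exps[of x], of "f x"] by (simp add: t_def sums_iff)
    moreover have "integral\<^sup>L lborel (t k) = c k * w ^ k" for k
    proof -
      have "t k = (\<lambda>x. (f x * (-\<i> * of_real x) ^ k / fact k) * w ^ k)"
        by (rule ext) (simp only: t_def power_mult_distrib times_divide_eq_left mult.assoc)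
      then show ?thesis
        unfolding c_def by (simp only: integral_mult_left_zero)
    qed
    ultimately show ?thesis
      by (simp add: fourier_def)
  qed
  then have "fourier f holomorphic_on ball 0 R" for R
    by (intro power_series_holomorphic)
  then have "fourier f field_differentiable (at w)" for w
    by (rule holomorphic_on_imp_differentiable_at[of _ "ball 0 (norm w + 1)"]) (auto simp: dist_norm)
  then show ?thesis
    by (auto simp: holomorphic_on_def field_differentiable_at_within)
qed

section \<open>Zeros of products of entire functions\<close>

lemma has_zero_of_order_times_nonzero:
  assumes f: "has_zero_of_order f d z" and h: "h analytic_on {z}" "h z \<noteq> 0"
  shows "has_zero_of_order (\<lambda>w. f w * h w) d z"
proof -
  have "eventually (\<lambda>w. h w \<noteq> 0) (at z)"
    using analytic_at_imp_isCont[OF h(1)] h(2)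
    by (metis isCont_def tendsto_imp_eventually_ne)
  moreover have "eventually (\<lambda>w. f w \<noteq> 0) (at z)"
    using f by (simp add: has_zero_of_order_def)
  ultimately have ev: "eventually (\<lambda>w. f w * h w \<noteq> 0) (at z)"
    by eventually_elim simp
  moreover have "zorder (\<lambda>w. f w * h w) z = zorder f z + zorder h z"
    using f h ev by (intro zorder_times_analytic) (auto simp: has_zero_of_order_def)
  moreover have "zorder h z = 0"
    using h by (intro zorder_eq_0I) auto
  ultimately show ?thesis
    using f h by (auto simp: has_zero_of_order_def intro!: analytic_intros)
qed

lemma has_zero_of_order_power:
  assumes f: "has_zero_of_order f d z" and "k > 0"
  shows "has_zero_of_order (\<lambda>w. f w ^ k) (k * d) z"
proof -
  have ev: "eventually (\<lambda>w. f w \<noteq> 0) (at z)" and an: "f analytic_on {z}"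
    using f by (auto simp: has_zero_of_order_def)
  have "zorder (\<lambda>w. f w ^ k) z = k * zorder f z"
    using an ev by (intro zorder_power analytic_on_imp_meromorphic_on eventually_frequently) auto
  then show ?thesis
    using assms ev by (auto simp: has_zero_of_order_def intro!: analytic_intros)
qed

text \<open>The Weierstrass test for infinite products. The majorant \<open>M\<close> may depend on the disc and
  needs to hold only from some index on, where a bound such as \<open>\<bar>exp u - 1\<bar> \<le> 3 / 2 * \<bar>u\<bar>\<close>
  for small \<open>u\<close> becomes applicable.\<close>

lemma entire_prodinf:
  fixes g :: "nat \<Rightarrow> complex \<Rightarrow> complex"
  assumes hol: "\<And>k. g k holomorphic_on UNIV"
    and bound: "\<And>R. \<exists>M. summable M \<and> (\<forall>\<^sub>F k in sequentially. \<forall>w\<in>cball 0 R. norm (g k w - 1) \<le> M k)"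
  shows convergent_prod_entire: "convergent_prod (\<lambda>k. g k w)"
    and holomorphic_prodinf: "(\<lambda>w. \<Prod>k. g k w) holomorphic_on UNIV"
proof -
  show conv: "convergent_prod (\<lambda>k. g k w)" for w
  proof -
    obtain M where M: "summable M" "\<forall>\<^sub>F k in sequentially. \<forall>w\<in>cball 0 (norm w). norm (g k w - 1) \<le> M k"
      using bound by blast
    from M(2) have "\<forall>\<^sub>F k in sequentially. norm (norm (g k w - 1)) \<le> M k"
      by eventually_elim auto
    then have "summable (\<lambda>k. norm (g k w - 1))"
      using M(1) by (rule summable_comparison_test_ev)
    then show ?thesis
      by (simp add: abs_convergent_prod_conv_summable abs_convergent_prod_imp_convergent_prod)
  qed
  have unif: "uniform_limit (cball 0 R) (\<lambda>N w. \<Prod>k<N. g k w) (\<lambda>w. \<Prod>k. g k w) sequentially" for R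
  proof -
    obtain M where M: "summable M" "\<forall>\<^sub>F k in sequentially. \<forall>w\<in>cball 0 R. norm (g k w - 1) \<le> M k"
      using bound by blast
    have "uniformly_convergent_on (cball 0 R) (\<lambda>N w. \<Prod>k<N. g k w)"
    proof (rule uniformly_convergent_on_prod')
      show "continuous_on (cball 0 R) (g k)" for k
        using hol holomorphic_on_imp_continuous_on continuous_on_subset by blast
      show "uniformly_convergent_on (cball 0 R) (\<lambda>N w. \<Sum>k<N. norm (g k w - 1))"
        using M by (intro Weierstrass_m_test'_ev[where M = M]) auto
    qed auto
    then have "uniform_limit (cball 0 R) (\<lambda>N w. \<Prod>k<N. g k w)
                 (\<lambda>w. lim (\<lambda>N. \<Prod>k<N. g k w)) sequentially"
      by (simp add: uniformly_convergent_uniform_limit_iff)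
    moreover have "lim (\<lambda>N. \<Prod>k<N. g k w) = (\<Prod>k. g k w)" for w
      using convergent_prod_LIMSEQ[OF conv[of w]]
      by (intro limI) (simp add: LIMSEQ_lessThan_iff_atMost)
    ultimately show ?thesis by simp
  qed
  show "(\<lambda>w. \<Prod>k. g k w) holomorphic_on UNIV"
  proof (rule holomorphic_uniform_sequence)
    show "(\<lambda>w. \<Prod>k<N. g k w) holomorphic_on UNIV" for N
      by (intro holomorphic_intros hol)
    fix z :: complex
    have "uniform_limit (cball z 1) (\<lambda>N w. \<Prod>k<N. g k w) (\<lambda>w. \<Prod>k. g k w) sequentially"
      by (rule uniform_limit_on_subset[OF unif[of "norm z + 1"]]) (simp add: cball_subset_cball_iff)
    then show "\<exists>d>0. cball z d \<subseteq> UNIV \<and>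
        uniform_limit (cball z d) (\<lambda>N w. \<Prod>k<N. g k w) (\<lambda>w. \<Prod>k. g k w) sequentially"
      by (intro exI[of _ 1]) auto
  qed auto
qed

text \<open>Replacing the vanishing factor by \<open>1\<close> leaves a product that satisfies the same majorant
  condition eventually, so it is entire. It is not zero at \<open>z\<close>, because a convergent infinite
  product vanishes only if one of its factors does.\<close>

lemma prodinf_has_zero_of_order:
  fixes g :: "nat \<Rightarrow> complex \<Rightarrow> complex"
  assumes hol: "\<And>k. g k holomorphic_on UNIV"
    and bound: "\<And>R. \<exists>M. summable M \<and> (\<forall>\<^sub>F k in sequentially. \<forall>w\<in>cball 0 R. norm (g k w - 1) \<le> M k)"
    and zero: "has_zero_of_order (g j) d z"
    and nonzero: "\<And>k. k \<noteq> j \<Longrightarrow> g k z \<noteq> 0"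
  shows "has_zero_of_order (\<lambda>w. \<Prod>k. g k w) d z"
proof -
  define h where "h = (\<lambda>k w. if k = j then 1 else g k w)"
  have hol': "h k holomorphic_on UNIV" for k
    using hol by (cases "k = j") (auto simp: h_def)
  have bound': "\<exists>M. summable M \<and> (\<forall>\<^sub>F k in sequentially. \<forall>w\<in>cball 0 R. norm (h k w - 1) \<le> M k)" for R
  proof -
    obtain M where M: "summable M" "\<forall>\<^sub>F k in sequentially. \<forall>w\<in>cball 0 R. norm (g k w - 1) \<le> M k"
      using bound by blast
    from M(2) eventually_gt_at_top[of j]
    have "\<forall>\<^sub>F k in sequentially. \<forall>w\<in>cball 0 R. norm (h k w - 1) \<le> M k"
      by eventually_elim (auto simp: h_def)
    with M(1) show ?thesis by blast
  qed
  note conv = convergent_prod_entire[OF hol' bound'] and hol_h = holomorphic_prodinf[OF hol' bound']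
  have split: "(\<Prod>k. g k w) = g j w * (\<Prod>k. h k w)" for w
  proof -
    have single: "(\<lambda>k. if k = j then g j w else 1) has_prod g j w"
      using has_prod_single[of j "\<lambda>_. g j w"] by simp
    have "(\<lambda>k. (if k = j then g j w else 1) * h k w) has_prod (g j w * (\<Prod>k. h k w))"
      using single conv[THEN convergent_prod_has_prod] by (rule has_prod_mult)
    also have "(\<lambda>k. (if k = j then g j w else 1) * h k w) = (\<lambda>k. g k w)"
      by (auto simp: h_def)
    finally show ?thesis
      by (metis has_prod_unique)
  qed
  have "(\<Prod>k. h k z) \<noteq> 0"
    using has_prod_eq_0_iff[OF conv[of z, THEN convergent_prod_has_prod]] nonzero
    by (auto simp: h_def)
  moreover have "(\<lambda>w. \<Prod>k. h k w) analytic_on {z}"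
    using hol_h by (meson UNIV_I analytic_at open_UNIV)
  ultimately show ?thesis
    unfolding split using zero by (intro has_zero_of_order_times_nonzero)
qed

section \<open>The mask symbols\<close>

lemma mask_symbol_0: "mask_symbol \<mu> n 0 z = (1 + z) / 2"
proof -
  have "mask_symbol \<mu> n 0 z = (\<Sum>\<alpha>\<in>{0,1}. of_real (mask \<mu> n 0 \<alpha>) * z ^ \<alpha>)"
    unfolding mask_symbol_def by (rule sum.mono_neutral_right) (auto simp: mask_def)
  then show ?thesis
    by (simp add: mask_def field_simps)
qed

text \<open>By the binomial theorem the two parts of the mask have the symbols \<open>(1 + z) ^ (n + 1)\<close>
  and \<open>4 (2 powr s - 1) z (1 + z) ^ (n - 1)\<close>. The common factor \<open>(1 + z) ^ (n - 1)\<close> is the source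
  of the zeros of order \<open>n - 1\<close>.\<close>

lemma mask_symbol_pos:
  fixes \<mu> :: real
  assumes "m > 0" "n \<ge> 1"
  defines "s \<equiv> real m powr (- \<mu>)"
  shows "mask_symbol \<mu> n m z =
    of_real (1 / 2 powr (real n + 1 + s)) * (1 + z) ^ (n - 1) *
      (1 + of_real (4 * 2 powr s - 2) * z + z\<^sup>2)"
proof -
  define c where "c = complex_of_real (1 / 2 powr (real n + 1 + s))"
  define t where "t = complex_of_real (2 powr s)"
  obtain p where n: "n = Suc p" using assms by (cases n) auto
  have A: "(\<Sum>\<alpha>\<le>n + 1. of_nat ((n + 1) choose \<alpha>) * z ^ \<alpha>) = (1 + z) ^ (n + 1)"
    using binomial_ring[of z 1 "n + 1"] by (simp add: add.commute)
  have "(\<Sum>\<alpha>\<le>n + 1. (if \<alpha> = 0 then 0 else of_nat ((n - 1) choose (\<alpha> - 1))) * z ^ \<alpha>)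
      = (\<Sum>\<alpha>\<le>n. of_nat ((n - 1) choose \<alpha>) * z ^ Suc \<alpha>)"
    unfolding Suc_eq_plus1[symmetric] by (subst sum.atMost_Suc_shift) simp
  also have "\<dots> = z * (\<Sum>\<alpha>\<le>p. of_nat (p choose \<alpha>) * z ^ \<alpha>)"
    by (simp add: n sum_distrib_left mult_ac)
  also have "\<dots> = z * (1 + z) ^ p"
    using binomial_ring[of z 1 p] by (simp add: add.commute)
  finally have B: "(\<Sum>\<alpha>\<le>n + 1. (if \<alpha> = 0 then 0 else of_nat ((n - 1) choose (\<alpha> - 1))) * z ^ \<alpha>) = z * (1 + z) ^ p" .
  have "mask_symbol \<mu> n m z = (\<Sum>\<alpha>\<le>n + 1. c * (of_nat ((n + 1) choose \<alpha>) * z ^ \<alpha>)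
      + c * (4 * (t - 1)) * ((if \<alpha> = 0 then 0 else of_nat ((n - 1) choose (\<alpha> - 1))) * z ^ \<alpha>))"
    unfolding mask_symbol_def
    by (rule sum.cong) (use assms in \<open>auto simp: mask_def c_def t_def s_def algebra_simps\<close>)
  also have "\<dots> = c * (1 + z) ^ (n + 1) + c * (4 * (t - 1)) * (z * (1 + z) ^ p)"
    by (simp only: sum.distrib sum_distrib_left[symmetric] A B)
  also have "\<dots> = c * (1 + z) ^ p * ((1 + z)\<^sup>2 + 4 * (t - 1) * z)"
    by (simp add: n algebra_simps power2_eq_square)
  also have "\<dots> = c * (1 + z) ^ (n - 1) * (1 + of_real (4 * 2 powr s - 2) * z + z\<^sup>2)"
    by (simp add: n t_def algebra_simps power2_eq_square)
  finally show ?thesis by (simp add: c_def)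
qed

lemma quadratic_factor_nonzero_on_circle:
  fixes z :: complex
  assumes "norm z = 1" "c > 2"
  shows "1 + of_real c * z + z\<^sup>2 \<noteq> 0"
proof
  assume "1 + of_real c * z + z\<^sup>2 = 0"
  then have "of_real c * z = - (1 + z\<^sup>2)"
    by (simp add: eq_neg_iff_add_eq_0 algebra_simps)
  then have "norm (of_real c * z) = norm (1 + z\<^sup>2)"
    by (metis norm_minus_cancel)
  also have "\<dots> \<le> 1 + norm (z\<^sup>2)"
    by (metis norm_one norm_triangle_ineq)
  finally show False
    using assms by (simp add: norm_mult norm_power)
qed

lemma quadratic_coefficient_gt_2:
  assumes "m > 0"
  shows "4 * 2 powr (real m powr (- \<mu>)) - 2 > (2::real)"
proof -
  have "(1::real) < 2 powr (real m powr (- \<mu>))"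
    using assms by (intro gr_one_powr) auto
  then show ?thesis by simp
qed

lemma mask_symbol_nonzero_on_circle:
  assumes "n \<ge> 1" "norm z = 1" "z \<noteq> -1"
  shows "mask_symbol \<mu> n m z \<noteq> 0"
proof -
  have z: "1 + z \<noteq> 0"
    using assms(3) by (metis add_eq_0_iff)
  show ?thesis
  proof (cases "m = 0")
    case True
    with z show ?thesis by (simp add: mask_symbol_0)
  next
    case False
    then show ?thesis
      using z assms quadratic_factor_nonzero_on_circle[OF assms(2) quadratic_coefficient_gt_2[of m \<mu>]]
      by (simp add: mask_symbol_pos)
  qed
qed

lemma mask_symbol_1:
  assumes "n \<ge> 1"
  shows "mask_symbol \<mu> n m 1 = 1"
proof (cases "m = 0")
  case False
  obtain p where n: "n = Suc p" using assms by (cases n) auto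
  define s where "s = real m powr (- \<mu>)"
  have "mask_symbol \<mu> n m 1 = of_real (1 / 2 powr (real n + 1 + s) * 2 ^ p * (4 * 2 powr s))"
    using False assms by (simp add: mask_symbol_pos s_def n)
  also have "2 powr (real n + 1 + s) = 4 * 2 ^ p * 2 powr s"
    by (simp add: n powr_add powr_realpow)
  finally show ?thesis by simp
qed (simp add: mask_symbol_0)

lemma mask_nonneg: "mask \<mu> n m \<alpha> \<ge> 0"
proof -
  have "2 powr (real m powr (- \<mu>)) \<ge> (1::real)"
    by (intro ge_one_powr_ge_zero) auto
  then show ?thesis
    by (auto simp: mask_def intro!: mult_nonneg_nonneg add_nonneg_nonneg)
qed

text \<open>The coefficients of the mask are nonnegative with sum \<open>1\<close>, so \<open>A (exp u) - 1\<close> is a convex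
  combination of the numbers \<open>exp (\<alpha> u) - 1\<close> with \<open>\<alpha> \<le> n + 1\<close>. The bound involves neither
  \<open>m\<close> nor \<open>\<mu>\<close>; it is therefore uniform over the factors of the infinite product.\<close>

lemma norm_mask_symbol_exp_minus_1_le:
  assumes "n \<ge> 1" and small: "real (n + 1) * norm u \<le> 1 / 2"
  shows "norm (mask_symbol \<mu> n m (exp u) - 1) \<le> 3 / 2 * (real (n + 1) * norm u)"
proof -
  have total: "(\<Sum>\<alpha>\<le>n + 1. mask \<mu> n m \<alpha>) = 1"
  proof -
    have "complex_of_real (\<Sum>\<alpha>\<le>n + 1. mask \<mu> n m \<alpha>) = 1"
      using mask_symbol_1[OF assms(1), of \<mu> m] by (simp add: mask_symbol_def)
    then show ?thesis using of_real_eq_1_iff by blast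
  qed
  have power: "norm (exp u ^ \<alpha> - 1) \<le> 3 / 2 * (real (n + 1) * norm u)" if "\<alpha> \<le> n + 1" for \<alpha>
  proof -
    have le: "norm (of_nat \<alpha> * u) \<le> real (n + 1) * norm u"
      using that by (simp add: norm_mult mult_right_mono del: of_nat_add of_nat_Suc)
    have "norm (exp (of_nat \<alpha> * u) - 1) \<le> 3 / 2 * norm (of_nat \<alpha> * u)"
      using le small by (intro norm_exp_bounds) linarith
    with le show ?thesis by (simp only: exp_of_nat_mult)
  qed
  have "mask_symbol \<mu> n m (exp u) - 1 = mask_symbol \<mu> n m (exp u) - of_real (\<Sum>\<alpha>\<le>n + 1. mask \<mu> n m \<alpha>)"
    by (simp only: total of_real_1)
  also have "\<dots> = (\<Sum>\<alpha>\<le>n + 1. of_real (mask \<mu> n m \<alpha>) * (exp u ^ \<alpha> - 1))"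
    by (simp only: mask_symbol_def of_real_sum sum_subtractf[symmetric] right_diff_distrib mult_1_right)
  also have "norm \<dots> \<le> (\<Sum>\<alpha>\<le>n + 1. mask \<mu> n m \<alpha> * (3 / 2 * (real (n + 1) * norm u)))"
  proof (rule sum_norm_le)
    fix \<alpha> assume "\<alpha> \<in> {..n + 1}"
    then show "norm (of_real (mask \<mu> n m \<alpha>) * (exp u ^ \<alpha> - 1))
        \<le> mask \<mu> n m \<alpha> * (3 / 2 * (real (n + 1) * norm u))"
      using power[of \<alpha>] mask_nonneg[of \<mu> n m \<alpha>]
      by (simp only: norm_mult norm_of_real abs_of_nonneg atMost_iff mult_left_mono)
  qed
  also have "\<dots> = 3 / 2 * (real (n + 1) * norm u)"
    by (simp only: sum_distrib_right[symmetric] total mult_1)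
  finally show ?thesis .
qed

section \<open>The factors of the infinite product\<close>

definition symbol_factor :: "real \<Rightarrow> nat \<Rightarrow> nat \<Rightarrow> nat \<Rightarrow> complex \<Rightarrow> complex" where
  "symbol_factor \<mu> n m k w = mask_symbol \<mu> n (m + k) (exp (- (\<i> * w / 2 ^ (m + k + 1))))"

lemma symbol_factor_entire: "symbol_factor \<mu> n m k holomorphic_on UNIV"
  unfolding symbol_factor_def[abs_def] mask_symbol_def by (intro holomorphic_intros) auto

lemma symbol_factor_bound:
  assumes "n \<ge> 1"
  shows "\<exists>M. summable M \<and>
    (\<forall>\<^sub>F k in sequentially. \<forall>w\<in>cball 0 R. norm (symbol_factor \<mu> n m k w - 1) \<le> M k)"
proof -
  define M where "M = (\<lambda>k. 3 / 2 * (real (n + 1) * (\<bar>R\<bar> / 2 ^ (m + k + 1))))"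
  have "M = (\<lambda>k. 3 / 2 * (real (n + 1) * (\<bar>R\<bar> / 2 ^ (m + 1))) * (1 / 2) ^ k)"
    by (auto simp: M_def power_add field_simps)
  then have "summable M"
    by (auto intro!: summable_mult summable_geometric)
  then have "M \<longlonglongrightarrow> 0"
    by (rule summable_LIMSEQ_zero)
  \<comment> \<open>This is the smallness condition \<open>(n + 1) * norm u \<le> 1 / 2\<close> of the symbol estimate,
    multiplied by \<open>3 / 2\<close>.\<close>
  then have "\<forall>\<^sub>F k in sequentially. M k < 3 / 4"
    by (rule order_tendstoD) simp
  then have "\<forall>\<^sub>F k in sequentially. \<forall>w\<in>cball 0 R. norm (symbol_factor \<mu> n m k w - 1) \<le> M k"
  proof eventually_elim
    case (elim k)
    show ?case
    proof
      fix w :: complex assume "w \<in> cball 0 R"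
      define u where "u = - (\<i> * w / 2 ^ (m + k + 1))"
      have "norm u \<le> \<bar>R\<bar> / 2 ^ (m + k + 1)"
        using \<open>w \<in> cball 0 R\<close> by (auto simp: u_def norm_divide norm_mult norm_power intro!: divide_right_mono)
      then have le: "real (n + 1) * norm u \<le> real (n + 1) * (\<bar>R\<bar> / 2 ^ (m + k + 1))"
        by (intro mult_left_mono) auto
      also have "\<dots> \<le> 1 / 2"
        using elim unfolding M_def by argo
      finally have "norm (symbol_factor \<mu> n m k w - 1) \<le> 3 / 2 * (real (n + 1) * norm u)"
        unfolding symbol_factor_def u_def[symmetric]
        using assms by (intro norm_mask_symbol_exp_minus_1_le)
      also have "\<dots> \<le> M k"
        using le unfolding M_def by argo
      finally show "norm (symbol_factor \<mu> n m k w - 1) \<le> M k" .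
    qed
  qed
  with \<open>summable M\<close> show ?thesis by blast
qed

lemma has_simple_zero_1_plus_exp:
  assumes "exp (- (\<i> * z / c)) = -1" "c \<noteq> 0"
  shows "has_zero_of_order (\<lambda>w. 1 + exp (- (\<i> * w / c))) 1 z"
proof -
  have an: "(\<lambda>w. 1 + exp (- (\<i> * w / c))) analytic_on {z}"
    using assms by (intro analytic_intros) auto
  have "((\<lambda>w. 1 + exp (- (\<i> * w / c))) has_field_derivative \<i> / c) (at z)"
    using assms by (auto intro!: derivative_eq_intros)
  then have deriv: "deriv (\<lambda>w. 1 + exp (- (\<i> * w / c))) z \<noteq> 0"
    using assms by (simp add: DERIV_imp_deriv)
  have "zorder (\<lambda>w. 1 + exp (- (\<i> * w / c))) z = 1"
    using assms deriv by (intro zorder_zero_eqI' an) auto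
  moreover have "\<forall>\<^sub>F w in at z. 1 + exp (- (\<i> * w / c)) \<noteq> 0 \<and> w \<in> UNIV"
    using assms by (intro non_zero_neighbour_alt[where \<beta> = 0] holomorphic_intros) auto
  ultimately show ?thesis
    using an assms by (auto simp: has_zero_of_order_def)
qed

text \<open>The zero comes from a power of \<open>1 + exp (-\<i> w / 2 ^ (m + k + 1))\<close>, whose zeros are simple;
  the cofactor is the quadratic evaluated at \<open>-1\<close> and does not vanish. The case \<open>m + k = 0\<close>
  is the only one in which the factor is made from the mask \<open>(1/2, 1/2)\<close>.\<close>

lemma symbol_factor_has_zero_of_order:
  fixes \<mu> :: real
  assumes "n \<ge> 2" and z: "exp (- (\<i> * of_real x / 2 ^ (m + k + 1))) = -1"
  shows "has_zero_of_order (symbol_factor \<mu> n m k) (if m + k = 0 then 1 else n - 1) (of_real x)"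
proof -
  define E where "E = (\<lambda>w. exp (- (\<i> * w / 2 ^ (m + k + 1))))"
  have E: "E (of_real x) = -1" and E_an: "E analytic_on {of_real x}"
    using z unfolding E_def by (auto intro!: analytic_intros)
  have simple: "has_zero_of_order (\<lambda>w. 1 + E w) 1 (of_real x)"
    unfolding E_def by (rule has_simple_zero_1_plus_exp[OF z]) simp
  show ?thesis
  proof (cases "m + k = 0")
    case True
    have "symbol_factor \<mu> n m k = (\<lambda>w. (1 + E w) * (1 / 2))"
      using True by (auto simp: symbol_factor_def E_def mask_symbol_0)
    moreover have "has_zero_of_order (\<lambda>w. (1 + E w) * (1 / 2)) 1 (of_real x)"
      by (intro has_zero_of_order_times_nonzero[OF simple]) auto
    ultimately show ?thesis using True by simp
  next
    case False
    define s where "s = real (m + k) powr (- \<mu>)"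
    define c where "c = complex_of_real (1 / 2 powr (real n + 1 + s))"
    define h where "h = (\<lambda>w. c * (1 + of_real (4 * 2 powr s - 2) * E w + (E w)\<^sup>2))"
    have "symbol_factor \<mu> n m k = (\<lambda>w. (1 + E w) ^ (n - 1) * h w)"
      using False assms
      by (auto simp: symbol_factor_def E_def h_def c_def s_def mask_symbol_pos mult_ac)
    moreover have "has_zero_of_order (\<lambda>w. (1 + E w) ^ (n - 1) * h w) (n - 1) (of_real x)"
    proof (rule has_zero_of_order_times_nonzero)
      show "has_zero_of_order (\<lambda>w. (1 + E w) ^ (n - 1)) (n - 1) (of_real x)"
        using has_zero_of_order_power[OF simple, of "n - 1"] assms by simp
      show "h analytic_on {of_real x}"
        unfolding h_def by (intro analytic_intros E_an)
      show "h (of_real x) \<noteq> 0"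
      proof -
        have "c \<noteq> 0"
          by (simp add: c_def)
        moreover have "4 * 2 powr s - 2 > 2"
          unfolding s_def using False by (intro quadratic_coefficient_gt_2) simp
        then have "1 + of_real (4 * 2 powr s - 2) * (- 1) + (- 1)\<^sup>2 \<noteq> (0 :: complex)"
          by (intro quadratic_factor_nonzero_on_circle) simp
        ultimately show ?thesis
          unfolding h_def E by (simp only: mult_eq_0_iff not_False_eq_True simp_thms)
      qed
    qed
    ultimately show ?thesis
      by (simp only: False if_False)
  qed
qed

text \<open>A real frequency \<open>x\<close> puts the argument of the symbol on the unit circle, where \<open>-1\<close> is the
  only possible zero.\<close>

lemma symbol_factor_nonzero:
  assumes "n \<ge> 1" "exp (- (\<i> * of_real x / 2 ^ (m + k + 1))) \<noteq> -1"
  shows "symbol_factor \<mu> n m k (of_real x) \<noteq> 0"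
proof -
  have "- (\<i> * of_real x / 2 ^ (m + k + 1)) = \<i> * complex_of_real (- x / 2 ^ (m + k + 1))"
    by simp
  then have "norm (exp (- (\<i> * complex_of_real x / 2 ^ (m + k + 1)))) = 1"
    by (metis norm_exp_i_times)
  then show ?thesis
    using assms unfolding symbol_factor_def by (intro mask_symbol_nonzero_on_circle)
qed

text \<open>The exponent reduces to \<open>-\<i> \<pi> \<alpha> / 2 ^ k\<close>, and \<open>exp (\<i> \<pi> x) = -1\<close> holds for real \<open>x\<close>
  exactly if \<open>x\<close> is an odd integer.\<close>

lemma exp_eq_minus_1_iff_odd_part:
  fixes \<alpha> :: int
  shows "exp (- (\<i> * of_real (2 ^ (m + 1) * pi * of_int \<alpha>) / 2 ^ (m + k + 1))) = -1
    \<longleftrightarrow> (\<exists>b. odd b \<and> \<alpha> = 2 ^ k * b)"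
proof -
  let ?u = "- (\<i> * of_real (2 ^ (m + 1) * pi * of_int \<alpha>) / 2 ^ (m + k + 1))"
  have "?u = \<i> * of_real (- (pi * of_int \<alpha> / 2 ^ k))"
    by (simp add: power_add)
  moreover have "\<i> * of_real pi + of_int (2 * q) * pi * \<i> = \<i> * of_real (pi * of_int (1 + 2 * q))" for q
    by (simp add: algebra_simps)
  ultimately have eq: "?u = \<i> * of_real pi + of_int (2 * q) * pi * \<i>
      \<longleftrightarrow> - (pi * of_int \<alpha> / 2 ^ k) = pi * of_int (1 + 2 * q)" for q
    by (simp only: mult_cancel_left of_real_eq_iff) simp
  have "- (pi * of_int \<alpha> / 2 ^ k) = pi * of_int (1 + 2 * q) \<longleftrightarrow> \<alpha> = 2 ^ k * (- (1 + 2 * q))" for q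
  proof -
    have "- (pi * of_int \<alpha> / 2 ^ k) = pi * of_int (1 + 2 * q)
        \<longleftrightarrow> real_of_int \<alpha> = 2 ^ k * (- of_int (1 + 2 * q))"
    proof -
      have "- (pi * real_of_int \<alpha> / 2 ^ k) = pi * (- (real_of_int \<alpha> / 2 ^ k))"
        by simp
      then show ?thesis
        by (simp only: mult_cancel_left pi_neq_zero) (auto simp: field_simps)
    qed
    also have "\<dots> \<longleftrightarrow> real_of_int \<alpha> = of_int (2 ^ k * (- (1 + 2 * q)))"
      by simp
    finally show ?thesis
      by (simp only: of_int_eq_iff)
  qed
  with eq have "?u = \<i> * of_real pi + of_int (2 * q) * pi * \<i> \<longleftrightarrow> \<alpha> = 2 ^ k * (- (1 + 2 * q))" for q
    by simp
  moreover have "exp ?u = -1 \<longleftrightarrow> (\<exists>q::int. ?u = \<i> * of_real pi + of_int (2 * q) * pi * \<i>)"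
    using exp_eq[of ?u "\<i> * of_real pi"] by simp
  moreover have "(\<exists>q::int. \<alpha> = 2 ^ k * (- (1 + 2 * q))) \<longleftrightarrow> (\<exists>b. odd b \<and> \<alpha> = 2 ^ k * b)"
  proof
    assume "\<exists>b. odd b \<and> \<alpha> = 2 ^ k * b"
    then obtain b where b: "odd b" "\<alpha> = 2 ^ k * b" by blast
    then obtain q where "- b = 2 * q + 1" by (metis oddE even_minus)
    then have "b = - (1 + 2 * q)" by simp
    with b show "\<exists>q::int. \<alpha> = 2 ^ k * (- (1 + 2 * q))" by blast
  next
    assume "\<exists>q::int. \<alpha> = 2 ^ k * (- (1 + 2 * q))"
    then obtain q where q: "\<alpha> = 2 ^ k * (- (1 + 2 * q))" by blast
    moreover have "odd (- (1 + 2 * q))" by simp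
    ultimately show "\<exists>b. odd b \<and> \<alpha> = 2 ^ k * b" by blast
  qed
  ultimately show ?thesis by simp
qed

lemma unique_power_of_two_odd_part:
  fixes b c :: int
  assumes "2 ^ j * b = 2 ^ k * c" "odd b" "odd c"
  shows "j = k"
proof -
  have "multiplicity 2 (2 ^ i * d) = i" if "odd d" for i and d :: int
    using that by (intro multiplicity_eqI) auto
  with assms show ?thesis by metis
qed

section \<open>Zeros of the Fourier transforms of the refinable functions\<close>

text \<open>The definition of a refinable function prescribes its Fourier transform on the real line
  only. Both sides being entire, the identity theorem extends the formula to complex
  frequencies.\<close>

lemma fourier_refinable_eq_prodinf:
  assumes "is_refinable_fun \<mu> n m \<phi>" "n \<ge> 1"
  shows "fourier \<phi> = (\<lambda>w. \<Prod>k. symbol_factor \<mu> n m k w)"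
proof
  fix w
  have "bounded {x. \<phi> x \<noteq> 0}"
    using assms(1) unfolding is_refinable_fun_def
    by (meson bounded_subset closure_subset compact_imp_bounded)
  then obtain r where r: "\<And>x. \<phi> x \<noteq> 0 \<Longrightarrow> \<bar>x\<bar> \<le> r"
    by (auto simp: bounded_real)
  moreover have "integrable lborel \<phi>"
    using assms(1) r unfolding is_refinable_fun_def
    by (intro integrable_of_square_integrable_bounded_support) auto
  ultimately have F: "fourier \<phi> holomorphic_on UNIV"
    by (intro fourier_entire)
  have G: "(\<lambda>w. \<Prod>k. symbol_factor \<mu> n m k w) holomorphic_on UNIV"
    using assms(2) by (intro holomorphic_prodinf symbol_factor_entire symbol_factor_bound)
  have "fourier \<phi> w - (\<Prod>k. symbol_factor \<mu> n m k w) = 0"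
  proof (rule analytic_continuation
      [where f = "\<lambda>w. fourier \<phi> w - (\<Prod>k. symbol_factor \<mu> n m k w)"
        and S = UNIV and U = "range of_real" and \<xi> = 0])
    show "(\<lambda>w. fourier \<phi> w - (\<Prod>k. symbol_factor \<mu> n m k w)) holomorphic_on UNIV"
      by (intro holomorphic_intros F G)
    show "0 islimpt (range complex_of_real)"
      unfolding islimpt_approachable
    proof safe
      fix e :: real assume "e > 0"
      then show "\<exists>x'\<in>range complex_of_real. x' \<noteq> 0 \<and> dist x' 0 < e"
        by (intro bexI[of _ "of_real (e / 2)"]) (auto simp del: of_real_divide)
    qed
    show "fourier \<phi> z - (\<Prod>k. symbol_factor \<mu> n m k z) = 0" if "z \<in> range complex_of_real" for z
      using that assms(1) by (auto simp: is_refinable_fun_def symbol_factor_def)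
  qed auto
  then show "fourier \<phi> w = (\<Prod>k. symbol_factor \<mu> n m k w)" by simp
qed

text \<open>The only factor that vanishes is the one whose index is the exponent of \<open>2\<close> in \<open>\<alpha>\<close>. For
  \<open>m = 0\<close> and odd \<open>\<alpha>\<close> this is the exceptional first factor \<open>(1 + z) / 2\<close>; in all other cases
  it is a factor with a zero of order \<open>n - 1\<close>.\<close>

lemma fourier_refinable_zero:
  fixes \<alpha> :: int
  assumes refinable: "is_refinable_fun \<mu> n m \<phi>" and "n \<ge> 2" "\<alpha> \<noteq> 0"
  shows "has_zero_of_order (fourier \<phi>) (if m = 0 \<and> odd \<alpha> then 1 else n - 1)
           (of_real (2 ^ (m + 1) * pi * of_int \<alpha>))"
proof -
  define x where "x = 2 ^ (m + 1) * pi * of_int \<alpha>"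
  define j where "j = multiplicity 2 \<alpha>"
  obtain b where b: "odd b" "\<alpha> = 2 ^ j * b"
    using multiplicity_decompose'[of \<alpha> 2] \<open>\<alpha> \<noteq> 0\<close> unfolding j_def by auto
  have vanishing: "exp (- (\<i> * of_real x / 2 ^ (m + k + 1))) = -1 \<longleftrightarrow> k = j" for k
    unfolding x_def exp_eq_minus_1_iff_odd_part
    using b unique_power_of_two_odd_part by blast
  have "has_zero_of_order (\<lambda>w. \<Prod>k. symbol_factor \<mu> n m k w) (if m + j = 0 then 1 else n - 1) (of_real x)"
  proof (rule prodinf_has_zero_of_order)
    show "has_zero_of_order (symbol_factor \<mu> n m j) (if m + j = 0 then 1 else n - 1) (of_real x)"
      using \<open>n \<ge> 2\<close> vanishing by (intro symbol_factor_has_zero_of_order) auto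
    show "symbol_factor \<mu> n m k (of_real x) \<noteq> 0" if "k \<noteq> j" for k
      using \<open>n \<ge> 2\<close> vanishing that by (intro symbol_factor_nonzero) auto
  qed (use \<open>n \<ge> 2\<close> in \<open>auto intro: symbol_factor_entire symbol_factor_bound\<close>)
  moreover have "j = 0 \<longleftrightarrow> odd \<alpha>"
    using b by (cases j) auto
  ultimately show ?thesis
    using fourier_refinable_eq_prodinf[OF refinable] \<open>n \<ge> 2\<close> unfolding x_def by simp
qed

theorem corollary4p2:
  fixes \<mu> :: real and n :: nat
  assumes "\<mu> > 1" and "n \<ge> 2"
  shows "(\<forall>m>0. \<forall>\<phi>. is_refinable_fun \<mu> n m \<phi> \<longrightarrow>
            (\<forall>\<alpha>::int. \<alpha> \<noteq> 0 \<longrightarrow>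
               has_zero_of_order (fourier \<phi>) (n - 1) (of_real (2 ^ (m + 1) * pi * of_int \<alpha>))))
       \<and> (\<forall>\<phi>. is_refinable_fun \<mu> n 0 \<phi> \<longrightarrow>
            (\<forall>\<alpha>::int. \<alpha> \<noteq> 0 \<longrightarrow>
               fourier \<phi> (of_real (2 * pi * of_int \<alpha>)) = 0
             \<and> (odd \<alpha> \<or> n = 2 \<longrightarrow>
                  has_zero_of_order (fourier \<phi>) 1 (of_real (2 * pi * of_int \<alpha>)))))"
proof (intro conjI allI impI)
  fix m \<phi> and \<alpha> :: int
  assume "m > 0" "is_refinable_fun \<mu> n m \<phi>" "\<alpha> \<noteq> 0"
  then show "has_zero_of_order (fourier \<phi>) (n - 1) (of_real (2 ^ (m + 1) * pi * of_int \<alpha>))"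
    using fourier_refinable_zero[of \<mu> n m \<phi> \<alpha>] \<open>n \<ge> 2\<close> by simp
next
  fix \<phi> and \<alpha> :: int
  assume "is_refinable_fun \<mu> n 0 \<phi>" "\<alpha> \<noteq> 0"
  then have zero: "has_zero_of_order (fourier \<phi>) (if odd \<alpha> then 1 else n - 1)
      (of_real (2 * pi * of_int \<alpha>))"
    using fourier_refinable_zero[of \<mu> n 0 \<phi> \<alpha>] \<open>n \<ge> 2\<close> by simp
  then show "fourier \<phi> (of_real (2 * pi * of_int \<alpha>)) = 0"
    unfolding has_zero_of_order_def by blast
  show "has_zero_of_order (fourier \<phi>) 1 (of_real (2 * pi * of_int \<alpha>))" if "odd \<alpha> \<or> n = 2"
    using zero that by (cases "odd \<alpha>") auto
qed

end
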